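(* We have \[ \begin{split} {\rm(a)}\ & \sum_{n\geq 1} q^{2n-1}(q^{2n+1};q^2)_{\infty}(q^{2n};q^2)_{\infty}(q^{2n+3};q^2)_{\infty}(q^{6};q^6)_{n-1} =\frac{(q^6;q^6)_\infty}{1+q+q^2} -\frac{(q^2;q^2)_\infty (q;q^2)_\infty^2}{1-q^3}, \\ {\rm(b)}\ & \sum_{n\geq 1} q^{2n-1}(q^{2n+1};q^2)_{\infty}(-q^{2n};q^2)_{\infty}(q^{2n+3};q^2)_{\infty}(-q^{6};q^6)_{n-1} =\frac{1}{1-q+q^2} \big((-q^6;q^6)_\infty-(-q^2,q^3,q;q^2)_\infty \big), \\ {\rm(c)}\ & \sum_{n\geq 1} \frac{q^{2n-1}}{(q^{2n-1};q^2)_{\infty}(q^{2n+1};q^2)_{\infty}(q^{2n+2};q^2)_{\infty}(q^{6};q^6)_{n}} =\frac{1}{1+q+q^2} \Big( \frac{1-q}{(q;q^2)_\infty^2 (q^2;q^2)_\infty} - \frac{1}{(q^6;q^6)_\infty}\Big), \\ {\rm(d)}\ & \sum_{n\geq 1} \frac{q^{2n-1}}{(q^{2n-1};q^2)_{\infty}(q^{2n+1};q^2)_{\infty}(-q^{2n+2};q^2)_{\infty}(-q^{6};q^6)_{n}} =\frac{1}{1-q+q^2} \Big( \frac{1}{(-q^2,q^3,q;q^2)_\infty} - \frac{1}{(-q^6;q^6)_\infty}\Big). \end{split} \]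
   Context: $q$ is a complex number with $|q|<1$. $(a;p)_0=1$, $(a;p)_n=\prod_{j=0}^{n-1}(1-ap^j)$, $(a;p)_\infty=\prod_{j\ge0}(1-ap^j)$ for a base $p$ with $|p|<1$, and $(a_1,\ldots,a_r;p)_\infty=\prod_{j=1}^r(a_j;p)_\infty$. *)

theory Defs
  imports "HOL-Analysis.Analysis"
begin

definition qpoch :: "complex \<Rightarrow> complex \<Rightarrow> nat \<Rightarrow> complex" where
  "qpoch a p n = (\<Prod>j<n. 1 - a * p ^ j)"

text \<open>The product below converges whenever \<^term>\<open>norm p < 1\<close>; a product
  with finitely many vanishing factors has value zero under \<^const>\<open>prodinf\<close>.\<close>
definition qpoch_inf :: "complex \<Rightarrow> complex \<Rightarrow> complex" where
  "qpoch_inf a p = prodinf (\<lambda>j. 1 - a * p ^ j)"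

definition qpoch_inf_list :: "complex list \<Rightarrow> complex \<Rightarrow> complex" where
  "qpoch_inf_list as p = (\<Prod>a\<leftarrow>as. qpoch_inf a p)"

end

theory Submission
  imports Defs
begin

text \<open>All four sums telescope. Put
  \[ F_n = (q^{2n+1}, s q^{2n+2}, q^{2n+3}; q^2)_\infty \, (s q^6; q^6)_n, \qquad s = \pm 1. \]
  With \(y = q^{2n+2}\), the identity
  \[ 1 - s y^3 - (1 - y/q)(1 - s y)(1 - q y) = (1 - s y) \, (y/q) \, (1 + s q + q^2) \]
  says that \(F_{n+1} - F_n\) is \(1 + s q + q^2\) times the general term of (a) or (b), and
  dividing it by \(F_n F_{n+1}\) shows that \(1/F_n - 1/F_{n+1}\) is the same multiple of the
  general term of (c) or (d). Finally \(F_n \to (s q^6; q^6)_\infty\).\<close>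

section \<open>Infinite q-products: convergence, shift, nonvanishing and tails\<close>

lemma qpoch_tendsto:
  assumes "norm p < 1"
  shows "qpoch a p \<longlonglongrightarrow> qpoch_inf a p"
proof -
  have "summable (\<lambda>j. norm (a * p ^ j))"
    using assms by (simp add: norm_mult norm_power summable_mult)
  then have "abs_convergent_prod (\<lambda>j. 1 - a * p ^ j)"
    by (simp add: abs_convergent_prod_conv_summable)
  then have "convergent_prod (\<lambda>j. 1 - a * p ^ j)"
    by (rule abs_convergent_prod_imp_convergent_prod)
  then have "(\<lambda>n. \<Prod>j\<le>n. 1 - a * p ^ j) \<longlonglongrightarrow> qpoch_inf a p"
    unfolding qpoch_inf_def by (rule convergent_prod_LIMSEQ)
  then have "(\<lambda>n. qpoch a p (Suc n)) \<longlonglongrightarrow> qpoch_inf a p"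
    by (simp add: qpoch_def lessThan_Suc_atMost)
  then show ?thesis
    by (rule LIMSEQ_imp_Suc)
qed

text \<open>Comparing limits of partial products avoids any division, so vanishing factors, for
  instance at \<open>a = 1\<close>, need no separate case.\<close>

lemma qpoch_inf_rec:
  assumes "norm p < 1"
  shows "qpoch_inf a p = (1 - a) * qpoch_inf (a * p) p"
proof (rule LIMSEQ_unique)
  show "(\<lambda>n. qpoch a p (Suc n)) \<longlonglongrightarrow> qpoch_inf a p"
    using qpoch_tendsto[OF assms] by (rule LIMSEQ_Suc)
  have "qpoch a p (Suc n) = (1 - a) * qpoch (a * p) p n" for n
    unfolding qpoch_def prod.lessThan_Suc_shift by (simp add: mult.assoc)
  then show "(\<lambda>n. qpoch a p (Suc n)) \<longlonglongrightarrow> (1 - a) * qpoch_inf (a * p) p"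
    using tendsto_mult[OF tendsto_const qpoch_tendsto[OF assms]] by simp
qed

lemma qpoch_inf_split:
  assumes "norm p < 1"
  shows "qpoch_inf a p = qpoch a p n * qpoch_inf (a * p ^ n) p"
proof (induction n)
  case 0
  show ?case by (simp add: qpoch_def)
next
  case (Suc n)
  then show ?case
    using qpoch_inf_rec[OF assms, of "a * p ^ n"] by (simp add: qpoch_def mult_ac)
qed

lemma qpoch_factor_nonzero:
  fixes a p :: complex
  assumes "norm a < 1" "norm p < 1"
  shows "1 - a * p ^ j \<noteq> 0"
proof
  assume "1 - a * p ^ j = 0"
  then have "norm (a * p ^ j) = 1" by simp
  moreover have "norm (a * p ^ j) \<le> norm a * 1"
    unfolding norm_mult norm_power
    using assms by (intro mult_left_mono power_le_one) auto
  ultimately show False using assms by simp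
qed

lemma qpoch_nonzero: "norm a < 1 \<Longrightarrow> norm p < 1 \<Longrightarrow> qpoch a p n \<noteq> 0"
  using qpoch_factor_nonzero by (simp add: qpoch_def)

lemma qpoch_inf_nonzero:
  assumes "norm a < 1" "norm p < 1"
  shows "qpoch_inf a p \<noteq> 0"
proof -
  have "summable (\<lambda>j. norm (a * p ^ j))"
    using assms by (simp add: norm_mult norm_power summable_mult)
  then have "abs_convergent_prod (\<lambda>j. 1 - a * p ^ j)"
    by (simp add: abs_convergent_prod_conv_summable)
  then show ?thesis
    unfolding qpoch_inf_def
    using prodinf_nonzero[OF abs_convergent_prod_imp_convergent_prod]
      qpoch_factor_nonzero[OF assms] by blast
qed

text \<open>The tail is the infinite product divided by its \<open>n\<close>-th partial product;
  \<open>norm a < 1\<close> keeps both nonzero.\<close>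

lemma qpoch_inf_tail_tendsto_1:
  assumes "norm a < 1" "norm p < 1"
  shows "(\<lambda>n. qpoch_inf (a * p ^ n) p) \<longlonglongrightarrow> 1"
proof -
  have "qpoch_inf (a * p ^ n) p = qpoch_inf a p / qpoch a p n" for n
    using qpoch_inf_split[OF assms(2), of a n] qpoch_nonzero[OF assms, of n]
    by (simp add: field_simps)
  moreover have "(\<lambda>n. qpoch_inf a p / qpoch a p n) \<longlonglongrightarrow> qpoch_inf a p / qpoch_inf a p"
    by (intro tendsto_intros qpoch_tendsto assms qpoch_inf_nonzero)
  ultimately show ?thesis
    using qpoch_inf_nonzero[OF assms] by simp
qed

text \<open>Telescoping alone gives only \<open>sums\<close>, while \<open>has_sum\<close> demands
  unordered summation. Splitting off \<open>p ^ n\<close> supplies absolute convergence: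
  \<open>b\<close> converges, hence is bounded, and a geometric series dominates.\<close>

lemma has_sum_telescope_geometric:
  fixes F b :: "nat \<Rightarrow> complex"
  assumes F: "F \<longlonglongrightarrow> L" and b: "b \<longlonglongrightarrow> B" and p: "norm p < 1" and c: "c \<noteq> 0"
    and diff: "\<And>n. F (Suc n) - F n = c * (a * p ^ n * b n)"
  shows "((\<lambda>n. a * p ^ n * b n) has_sum ((L - F 0) / c)) UNIV"
proof (rule norm_summable_imp_has_sum)
  from b have "Bseq b"
    by (intro convergent_imp_Bseq convergentI)
  then obtain K where K: "\<And>n. norm (b n) \<le> K"
    unfolding Bseq_def by blast
  show "summable (\<lambda>n. norm (a * p ^ n * b n))"
  proof (rule summable_comparison_test')
    show "summable (\<lambda>n. norm a * norm p ^ n * K)"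
      using p by (intro summable_mult summable_mult2 summable_geometric) simp
    show "norm (norm (a * p ^ n * b n)) \<le> norm a * norm p ^ n * K" if "0 \<le> n" for n
      using K[of n] by (simp add: norm_mult norm_power mult_left_mono)
  qed
  have "(\<lambda>n. (F (Suc n) - F n) / c) sums ((L - F 0) / c)"
    by (intro sums_divide telescope_sums F)
  then show "(\<lambda>n. a * p ^ n * b n) sums ((L - F 0) / c)"
    using c by (simp add: diff)
qed

lemma has_sum_atLeast_1_iff:
  "(f has_sum S) {1::nat..} \<longleftrightarrow> ((\<lambda>n. f (Suc n)) has_sum S) UNIV"
proof -
  have "range Suc = {1..}"
    by (simp add: Suc_le_eq lessThan_def atLeast_def image_def set_eq_iff) (metis gr0_conv_Suc)
  then show ?thesis
    using has_sum_reindex[of Suc UNIV f S] by (simp add: comp_def)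
qed

section \<open>The telescoping product, for both signs at once\<close>

context
  fixes q s :: complex
  assumes q: "norm q < 1" and s: "s\<^sup>2 = 1"
begin

private definition tail :: "complex \<Rightarrow> nat \<Rightarrow> complex" where
  "tail a n = qpoch_inf (a * (q\<^sup>2) ^ n) (q\<^sup>2)"

private definition F :: "nat \<Rightarrow> complex" where
  "F n = tail q n * tail (s * q\<^sup>2) n * tail (q ^ 3) n * qpoch (s * q ^ 6) (q ^ 6) n"

private lemma norm_s: "norm s = 1"
  using s by (metis norm_one norm_power norm_ge_zero power2_eq_1_iff norm_minus_cancel)

private lemma norm_q_power: "0 < k \<Longrightarrow> norm (q ^ k) < 1"
  using q by (simp add: norm_power power_less_one_iff)

private lemma norm_s_q_power: "0 < k \<Longrightarrow> norm (s * q ^ k) < 1"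
  using norm_q_power by (simp add: norm_mult norm_s)

private lemma tail_Suc: "tail a n = (1 - a * (q\<^sup>2) ^ n) * tail a (Suc n)"
  using qpoch_inf_rec[OF norm_q_power[of 2], of "a * (q\<^sup>2) ^ n"]
  by (simp add: tail_def mult_ac)

text \<open>The first and third tails in \<open>F\<close> are one sequence shifted by a step, which
  gives \<open>F n\<close> and \<open>F (Suc n)\<close> a large common factor.\<close>

private lemma tail_q_Suc: "tail q (Suc n) = tail (q ^ 3) n"
  by (simp add: tail_def power3_eq_cube power2_eq_square mult_ac)

private lemma tail_tendsto: "norm a < 1 \<Longrightarrow> tail a \<longlonglongrightarrow> 1"
  unfolding tail_def by (intro qpoch_inf_tail_tendsto_1 norm_q_power) simp_all

private lemma tail_nonzero: "norm a < 1 \<Longrightarrow> tail a n \<noteq> 0"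
proof -
  assume a: "norm a < 1"
  have "norm (a * (q\<^sup>2) ^ n) \<le> norm a * 1"
    unfolding norm_mult norm_power
    using q by (intro mult_left_mono power_le_one) auto
  with a show ?thesis
    unfolding tail_def by (intro qpoch_inf_nonzero norm_q_power) auto
qed

private lemma tail_nonzeros:
  "tail q n \<noteq> 0" "tail (s * q\<^sup>2) n \<noteq> 0" "tail (q ^ 3) n \<noteq> 0" "qpoch (s * q ^ 6) (q ^ 6) n \<noteq> 0"
  by (intro tail_nonzero qpoch_nonzero norm_q_power norm_s_q_power q; simp)+

private lemma F_nonzero: "F n \<noteq> 0"
  by (simp add: F_def tail_nonzeros)

private lemma limits:
  "tail q \<longlonglongrightarrow> 1" "tail (s * q\<^sup>2) \<longlonglongrightarrow> 1" "tail (q ^ 3) \<longlonglongrightarrow> 1"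
  "qpoch (s * q ^ 6) (q ^ 6) \<longlonglongrightarrow> qpoch_inf (s * q ^ 6) (q ^ 6)"
  by (intro tail_tendsto qpoch_tendsto norm_q_power norm_s_q_power q; simp)+

private lemma qpoch_inf_s_nonzero: "qpoch_inf (s * q ^ 6) (q ^ 6) \<noteq> 0"
  by (intro qpoch_inf_nonzero norm_q_power norm_s_q_power) simp_all

private lemma F_tendsto: "F \<longlonglongrightarrow> qpoch_inf (s * q ^ 6) (q ^ 6)"
  unfolding F_def
  using tendsto_mult[OF tendsto_mult[OF tendsto_mult[OF limits(1,2)] limits(3)] limits(4)] by simp

private lemma F_0: "F 0 = qpoch_inf q (q\<^sup>2) * qpoch_inf (s * q\<^sup>2) (q\<^sup>2) * qpoch_inf (q ^ 3) (q\<^sup>2)"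
  by (simp add: F_def tail_def qpoch_def)

text \<open>Since \<open>s\<^sup>2 = 1\<close>, this is the cofactor of \<open>1 - s * q\<close> in
  \<open>1 - (s * q) ^ 3 = 1 - s * q ^ 3\<close>, which cannot vanish inside the unit disc.\<close>

lemma one_plus_sq_plus_q2_nonzero: "1 + s * q + q\<^sup>2 \<noteq> 0"
proof
  assume "1 + s * q + q\<^sup>2 = 0"
  then have "(1 - s * q) * (1 + s * q + q\<^sup>2) = 0" by simp
  moreover have "(1 - s * q) * (1 + s * q + q\<^sup>2) = 1 - s * q ^ 3"
    using s by algebra
  ultimately have "s * q ^ 3 = 1" by simp
  then show False
    using norm_s_q_power[of 3] by simp
qed

private lemma F_diff:
  "F (Suc n) - F n = (1 + s * q + q\<^sup>2) *
     (q * (q\<^sup>2) ^ n * (tail (q ^ 3) n * tail (s * q\<^sup>2) n * tail (q ^ 3) (Suc n)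
       * qpoch (s * q ^ 6) (q ^ 6) n))"
proof -
  \<comment> \<open>The \<open>y\<close> of the overview is \<open>q\<^sup>2 * Y\<close>.\<close>
  define Y where "Y = (q\<^sup>2) ^ n"
  have Y: "(q ^ 6) ^ n = Y ^ 3"
    unfolding Y_def by (simp flip: power_mult add: mult.commute)
  have Q: "qpoch (s * q ^ 6) (q ^ 6) (Suc n) = qpoch (s * q ^ 6) (q ^ 6) n * (1 - s * q ^ 6 * Y ^ 3)"
    by (simp add: qpoch_def Y)
  have 1: "tail q n = (1 - q * Y) * tail (q ^ 3) n"
    by (subst tail_Suc) (simp add: tail_q_Suc Y_def)
  have 2: "tail (s * q\<^sup>2) n = (1 - s * q\<^sup>2 * Y) * tail (s * q\<^sup>2) (Suc n)"
    by (subst tail_Suc) (simp add: Y_def)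
  have 3: "tail (q ^ 3) n = (1 - q ^ 3 * Y) * tail (q ^ 3) (Suc n)"
    by (subst tail_Suc) (simp add: Y_def)
  have id: "1 - s * q ^ 6 * Y ^ 3 - (1 - q * Y) * (1 - s * q\<^sup>2 * Y) * (1 - q ^ 3 * Y)
      = (1 + s * q + q\<^sup>2) * (q * Y) * (1 - s * q\<^sup>2 * Y)"
    using s by algebra
  \<comment> \<open>The common factor of \<open>F n\<close> and \<open>F (Suc n)\<close>; the two
    cofactors are the terms on the left of \<open>id\<close>.\<close>
  let ?P = "tail (q ^ 3) n * tail (s * q\<^sup>2) (Suc n) * tail (q ^ 3) (Suc n) * qpoch (s * q ^ 6) (q ^ 6) n"
  have "F (Suc n) = ?P * (1 - s * q ^ 6 * Y ^ 3)"
    unfolding F_def Q tail_q_Suc by (simp only: mult_ac)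
  moreover have "F n = ?P * ((1 - q * Y) * (1 - s * q\<^sup>2 * Y) * (1 - q ^ 3 * Y))"
    unfolding F_def using 1 2 3 by algebra
  ultimately have "F (Suc n) - F n = ?P * ((1 + s * q + q\<^sup>2) * (q * Y) * (1 - s * q\<^sup>2 * Y))"
    unfolding id[symmetric] by (simp only: right_diff_distrib)
  \<comment> \<open>The leftover factor \<open>1 - s * q\<^sup>2 * Y\<close> is absorbed by fact
    \<open>2\<close>, turning the shifted tail back into
    \<open>tail (s * q\<^sup>2) n\<close>.\<close>
  then show ?thesis
    using 2 unfolding Y_def[symmetric] by algebra
qed

private lemma power_conv:
  "q ^ (2 * n + 1) = q * (q\<^sup>2) ^ n"
  "q ^ (2 * n + 2) = q\<^sup>2 * (q\<^sup>2) ^ n"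
  "q ^ (2 * n + 3) = q ^ 3 * (q\<^sup>2) ^ n"
  "q ^ (2 * n + 4) = q\<^sup>2 * (q\<^sup>2) ^ Suc n"
  "q ^ (2 * n + 5) = q ^ 3 * (q\<^sup>2) ^ Suc n"
  by (simp_all flip: power_mult power_add add: power_Suc[symmetric] numeral_eq_Suc del: power_Suc)

text \<open>Series (a) for \<open>s = 1\<close> and (b) for \<open>s = -1\<close>, with the index
  lowered by one so that summation starts at 0.\<close>

lemma telescoping_has_sum:
  "((\<lambda>n. q ^ (2*n + 1) * qpoch_inf (q ^ (2*n + 3)) (q\<^sup>2) * qpoch_inf (s * q ^ (2*n + 2)) (q\<^sup>2)
        * qpoch_inf (q ^ (2*n + 5)) (q\<^sup>2) * qpoch (s * q ^ 6) (q ^ 6) n)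
     has_sum ((qpoch_inf (s * q ^ 6) (q ^ 6)
       - qpoch_inf q (q\<^sup>2) * qpoch_inf (s * q\<^sup>2) (q\<^sup>2) * qpoch_inf (q ^ 3) (q\<^sup>2))
       / (1 + s * q + q\<^sup>2))) UNIV"
proof -
  have "(\<lambda>n. tail (q ^ 3) n * tail (s * q\<^sup>2) n * tail (q ^ 3) (Suc n) * qpoch (s * q ^ 6) (q ^ 6) n)
      \<longlonglongrightarrow> 1 * 1 * 1 * qpoch_inf (s * q ^ 6) (q ^ 6)"
    by (intro tendsto_mult limits LIMSEQ_Suc)
  from has_sum_telescope_geometric
    [OF F_tendsto this norm_q_power[of 2] one_plus_sq_plus_q2_nonzero F_diff]
  show ?thesis
    unfolding F_0 power_conv tail_def by (simp only: mult_ac)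
qed

lemma telescoping_inverse_has_sum:
  "((\<lambda>n. q ^ (2*n + 1) / (qpoch_inf (q ^ (2*n + 1)) (q\<^sup>2) * qpoch_inf (q ^ (2*n + 3)) (q\<^sup>2)
        * qpoch_inf (s * q ^ (2*n + 4)) (q\<^sup>2) * qpoch (s * q ^ 6) (q ^ 6) (Suc n)))
     has_sum ((1 / (qpoch_inf q (q\<^sup>2) * qpoch_inf (s * q\<^sup>2) (q\<^sup>2) * qpoch_inf (q ^ 3) (q\<^sup>2))
       - 1 / qpoch_inf (s * q ^ 6) (q ^ 6)) / (1 + s * q + q\<^sup>2))) UNIV"
proof -
  \<comment> \<open>What remains of \<open>1 / (F n * F (Suc n))\<close> once the tails and the
    finite product in \<open>F_diff\<close> have cancelled.\<close>
  define b where "b n = 1 / (tail q n * tail (q ^ 3) n * tail (s * q\<^sup>2) (Suc n)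
    * qpoch (s * q ^ 6) (q ^ 6) (Suc n))" for n
  have b: "b \<longlonglongrightarrow> 1 / (1 * 1 * 1 * qpoch_inf (s * q ^ 6) (q ^ 6))"
    unfolding b_def
    by (intro tendsto_divide tendsto_const tendsto_mult limits limits[THEN LIMSEQ_Suc])
       (simp add: qpoch_inf_s_nonzero)
  \<comment> \<open>The minus sign makes the forward difference equal to
    \<open>1 / F n - 1 / F (Suc n)\<close>, so the constant stays
    \<open>1 + s * q + q\<^sup>2\<close>.\<close>
  have lim: "(\<lambda>n. - (1 / F n)) \<longlonglongrightarrow> - (1 / qpoch_inf (s * q ^ 6) (q ^ 6))"
    by (intro tendsto_intros F_tendsto qpoch_inf_s_nonzero)
  have diff: "- (1 / F (Suc n)) - - (1 / F n) = (1 + s * q + q\<^sup>2) * (q * (q\<^sup>2) ^ n * b n)" for n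
  proof -
    have "- (1 / F (Suc n)) - - (1 / F n) = (F (Suc n) - F n) / (F n * F (Suc n))"
      using F_nonzero by (simp add: field_simps)
    also have "\<dots> = (1 + s * q + q\<^sup>2) * (q * (q\<^sup>2) ^ n * b n)"
      unfolding F_diff unfolding b_def F_def tail_q_Suc
      using tail_nonzeros[of n] tail_nonzeros[of "Suc n"] by simp
    finally show ?thesis .
  qed
  from has_sum_telescope_geometric
    [OF lim b norm_q_power[of 2] one_plus_sq_plus_q2_nonzero diff]
  have "((\<lambda>n. q * (q\<^sup>2) ^ n * b n) has_sum
      ((1 / F 0 - 1 / qpoch_inf (s * q ^ 6) (q ^ 6)) / (1 + s * q + q\<^sup>2))) UNIV"
    by simp
  then show ?thesis
    unfolding F_0 b_def tail_def power_conv by (simp add: mult.assoc)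
qed

end

section \<open>Specialization to the two signs and the closed forms\<close>

theorem theorem2p6:
  fixes q :: complex
  assumes "norm q < 1"
  shows
    "((\<lambda>n::nat. q ^ (2*n - 1) * qpoch_inf (q ^ (2*n + 1)) (q ^ 2) * qpoch_inf (q ^ (2*n)) (q ^ 2)
          * qpoch_inf (q ^ (2*n + 3)) (q ^ 2) * qpoch (q ^ 6) (q ^ 6) (n - 1))
       has_sum
         (qpoch_inf (q ^ 6) (q ^ 6) / (1 + q + q ^ 2)
          - qpoch_inf (q ^ 2) (q ^ 2) * (qpoch_inf q (q ^ 2)) ^ 2 / (1 - q ^ 3))) {1..}
     \<and>
     ((\<lambda>n::nat. q ^ (2*n - 1) * qpoch_inf (q ^ (2*n + 1)) (q ^ 2) * qpoch_inf (- (q ^ (2*n))) (q ^ 2)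
          * qpoch_inf (q ^ (2*n + 3)) (q ^ 2) * qpoch (- (q ^ 6)) (q ^ 6) (n - 1))
       has_sum
         (1 / (1 - q + q ^ 2)
          * (qpoch_inf (- (q ^ 6)) (q ^ 6) - qpoch_inf_list [- (q ^ 2), q ^ 3, q] (q ^ 2)))) {1..}
     \<and>
     ((\<lambda>n::nat. q ^ (2*n - 1) /
          (qpoch_inf (q ^ (2*n - 1)) (q ^ 2) * qpoch_inf (q ^ (2*n + 1)) (q ^ 2)
           * qpoch_inf (q ^ (2*n + 2)) (q ^ 2) * qpoch (q ^ 6) (q ^ 6) n))
       has_sum
         (1 / (1 + q + q ^ 2)
          * ((1 - q) / ((qpoch_inf q (q ^ 2)) ^ 2 * qpoch_inf (q ^ 2) (q ^ 2))
             - 1 / qpoch_inf (q ^ 6) (q ^ 6)))) {1..}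
     \<and>
     ((\<lambda>n::nat. q ^ (2*n - 1) /
          (qpoch_inf (q ^ (2*n - 1)) (q ^ 2) * qpoch_inf (q ^ (2*n + 1)) (q ^ 2)
           * qpoch_inf (- (q ^ (2*n + 2))) (q ^ 2) * qpoch (- (q ^ 6)) (q ^ 6) n))
       has_sum
         (1 / (1 - q + q ^ 2)
          * (1 / qpoch_inf_list [- (q ^ 2), q ^ 3, q] (q ^ 2)
             - 1 / qpoch_inf (- (q ^ 6)) (q ^ 6)))) {1..}"
proof -
  have q2: "norm (q\<^sup>2) < 1"
    using assms by (simp add: norm_power power_less_one_iff)
  have ne: "1 - q \<noteq> 0" "1 + q + q\<^sup>2 \<noteq> 0"
    using assms one_plus_sq_plus_q2_nonzero[OF assms, of 1] by auto
  \<comment> \<open>This trades the factor with \<open>q ^ 3\<close> for a second one with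
    \<open>q\<close>, producing the squares in (a) and (c); (b) and (d) keep both factors.\<close>
  have rec: "qpoch_inf q (q\<^sup>2) = (1 - q) * qpoch_inf (q ^ 3) (q\<^sup>2)"
    using qpoch_inf_rec[OF q2, of q] by (simp add: power3_eq_cube power2_eq_square mult_ac)
  have cube: "1 - q ^ 3 = (1 - q) * (1 + q + q\<^sup>2)"
    by algebra
  \<comment> \<open>After the shift to \<open>Suc n\<close>, the truncated subtraction in
    \<open>2*n - 1\<close> is a genuine one.\<close>
  have index: "2 * Suc n - 1 = 2*n + 1" "2 * Suc n = 2*n + 2" "2*n + 2 + 1 = 2*n + 3"
      "2*n + 2 + 2 = 2*n + 4" "2*n + 2 + 3 = 2*n + 5" for n :: nat
    by simp_all
  have a: "(qpoch_inf (q ^ 6) (q ^ 6)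
        - qpoch_inf q (q\<^sup>2) * qpoch_inf (q\<^sup>2) (q\<^sup>2) * qpoch_inf (q ^ 3) (q\<^sup>2)) / (1 + q + q\<^sup>2)
      = qpoch_inf (q ^ 6) (q ^ 6) / (1 + q + q\<^sup>2)
        - qpoch_inf (q\<^sup>2) (q\<^sup>2) * (qpoch_inf q (q\<^sup>2))\<^sup>2 / (1 - q ^ 3)"
    unfolding cube rec diff_divide_distrib using ne(1) by (simp add: power2_eq_square)
  have c: "(1 / (qpoch_inf q (q\<^sup>2) * qpoch_inf (q\<^sup>2) (q\<^sup>2) * qpoch_inf (q ^ 3) (q\<^sup>2))
        - 1 / qpoch_inf (q ^ 6) (q ^ 6)) / (1 + q + q\<^sup>2)
      = 1 / (1 + q + q\<^sup>2)
        * ((1 - q) / ((qpoch_inf q (q\<^sup>2))\<^sup>2 * qpoch_inf (q\<^sup>2) (q\<^sup>2)) - 1 / qpoch_inf (q ^ 6) (q ^ 6))"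
    unfolding rec using ne(1) by (simp add: power2_eq_square)
  show ?thesis
    unfolding has_sum_atLeast_1_iff index diff_Suc_1 a[symmetric] c[symmetric]
    using telescoping_has_sum[OF assms, of 1] telescoping_has_sum[OF assms, of "- 1"]
      telescoping_inverse_has_sum[OF assms, of 1] telescoping_inverse_has_sum[OF assms, of "- 1"]
    \<comment> \<open>The deleted rules would break up the exponents and the products that have to
      match the two telescoping lemmas.\<close>
    by (simp add: qpoch_inf_list_def mult_ac del: mult_Suc_right power_Suc)
qed

end
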